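(* Let $\Gamma$ be a graph and let $G \leq \mathrm{Aut}(\Gamma)$ be such that the quotient graph $\Gamma/G$ is connected. Let $\mathcal{T}_V$ be a transversal of $V(\Gamma)/G$ and let $\mathcal{T}_D$ be a transversal of $D(\Gamma)/G$ such that $x \in \mathcal{T}_D$ implies $\mathrm{beg}\, x \in \mathcal{T}_V$ (such a pair of transversals always exists). Set $\mathcal{T}:= \mathcal{T}_D \cup \mathcal{T}_V$, so that every vertex or dart of $\Gamma/G$ can be written uniquely as $x^G$ with $x \in \mathcal{T}$. For $x\in\mathcal{T}_D$ let $\iota(x)$ be the unique element of $\mathcal{T}_D$ such that $x^{-1} \in \iota(x)^G$. Let $\zeta\colon D(\Gamma/G) \to G$ be a function such that $$\iota(x)^{\zeta(x^G)} = x^{-1} \quad\text{for every } x \in \mathcal{T}_D.$$ Define $\omega\colon V(\Gamma/G) \cup D(\Gamma/G) \to S(G)$ by letting $\omega(x^G):=G_x$ for every $x \in \mathcal{T}$. Then the quadruple $(\Gamma/G, G, \omega,\zeta)$ is a generalised voltage graph and there exists an isomorphism between $\Gamma$ and $\mathrm{GenCov}(\Gamma/G,G,\omega,\zeta)$ which maps every $G$-orbit on $V(\Gamma) \cup D(\Gamma)$ bijectively to a fibre of the generalised cover $\mathrm{GenCov}(\Gamma/G,G,\omega,\zeta)$.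
   Context: Graphs. A graph is a quadruple $(V,D,\mathrm{beg},\mathrm{inv})$ where $V$ is a non-empty set of vertices, $D$ is a set of darts (disjoint from $V$), $\mathrm{beg}\colon D\to V$, and $\mathrm{inv}\colon D\to D$ satisfies $\mathrm{inv}\,\mathrm{inv}\,x=x$ for all $x\in D$. For $\Gamma=(V,D,\mathrm{beg},\mathrm{inv})$ write $V(\Gamma)=V$, $D(\Gamma)=D$, $\mathrm{beg}_\Gamma=\mathrm{beg}$, $\mathrm{inv}_\Gamma=\mathrm{inv}$; also $x^{-1}:=\mathrm{inv}\,x$ and $\mathrm{end}\,x:=\mathrm{beg}\,x^{-1}$. A walk is a sequence of darts $(x_1,\dots,x_n)$ with $\mathrm{end}\,x_i=\mathrm{beg}\,x_{i+1}$; a walk of length $0$ is regarded as a walk from any vertex to itself. A graph is connected if for any two vertices $u,v$ there is a walk from $u$ to $v$. A morphism is a function mapping vertices to vertices and darts to darts and commuting with $\mathrm{beg}$ and $\mathrm{inv}$; an isomorphism is a bijective morphism; an automorphism is an isomorphism of a graph onto itself. $\mathrm{Aut}(\Gamma)$ acts on the right (image of $x$ under $g$ is $x^g$, and $x^{gh}=(x^g)^h$). Quotients. For a group $G$ acting on a set $\Omega$, $\Omega/G$ is the set of orbits $x^G$; a transversal of $\Omega/G$ is a subset of $\Omega$ containing precisely one element of each orbit. $G_x$ is the stabiliser of $x$ in $G$. For $G\le \mathrm{Aut}(\Gamma)$, $\Gamma/G$ is the graph with vertex set $V(\Gamma)/G$, dart set $D(\Gamma)/G$, $\mathrm{beg}(x^G)=(\mathrm{beg}\,x)^G$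 and $\mathrm{inv}(x^G)=(\mathrm{inv}\,x)^G$. Generalised voltage graphs. For a group $G$, $S(G)$ is the set of all subgroups of $G$, and $g^h:=h^{-1}gh$, $H^h:=h^{-1}Hh$. A generalised voltage graph is a quadruple $(\Delta,G,\omega,\zeta)$ where $\Delta$ is a connected graph, $G$ is a group, and $\omega\colon V(\Delta)\cup D(\Delta)\to S(G)$ and $\zeta\colon D(\Delta)\to G$ satisfy, for all $x\in D(\Delta)$: $\omega(x)\le\omega(\mathrm{beg}_\Delta x)$; $\omega(x)=\omega(x^{-1})^{\zeta(x)}$; and $\zeta(x^{-1})\zeta(x)\in\omega(x)$. Generalised cover. $\mathrm{GenCov}(\Delta,G,\omega,\zeta)$ is the graph $\Theta$ with $V(\Theta)=\{(v,\omega(v)g): v\in V(\Delta), g\in G\}$, $D(\Theta)=\{(x,\omega(x)g): x\in D(\Delta), g\in G\}$, $\mathrm{beg}_\Theta(x,\omega(x)g)=(\mathrm{beg}_\Delta x,\omega(\mathrm{beg}_\Delta x)g)$ and $\mathrm{inv}_\Theta(x,\omega(x)g)=(x^{-1},\omega(x^{-1})\zeta(x)g)$ (right cosets). The fibre above $x\in V(\Delta)\cup D(\Delta)$ is the set $\{(x,\omega(x)g): g\in G\}$. *)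

theory Defs
  imports "HOL-Algebra.Group_Action"
begin

section \<open>Graphs with darts\<close>

text \<open>Vertices and darts are taken from one type and kept disjoint by an axiom, so that a
  morphism is a single function on the union of the two sets.\<close>

record 'a dgraph =
  verts :: "'a set"
  darts :: "'a set"
  beg :: "'a \<Rightarrow> 'a"
  dinv :: "'a \<Rightarrow> 'a"

definition is_dgraph :: "'a dgraph \<Rightarrow> bool" where
  "is_dgraph \<Gamma> \<longleftrightarrow>
     verts \<Gamma> \<noteq> {} \<and> verts \<Gamma> \<inter> darts \<Gamma> = {} \<and>
     beg \<Gamma> \<in> darts \<Gamma> \<rightarrow> verts \<Gamma> \<and> dinv \<Gamma> \<in> darts \<Gamma> \<rightarrow> darts \<Gamma> \<and>
     (\<forall>x \<in> darts \<Gamma>. dinv \<Gamma> (dinv \<Gamma> x) = x)"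

definition elems :: "'a dgraph \<Rightarrow> 'a set" where
  "elems \<Gamma> = verts \<Gamma> \<union> darts \<Gamma>"

definition dend :: "'a dgraph \<Rightarrow> 'a \<Rightarrow> 'a" where
  "dend \<Gamma> x = beg \<Gamma> (dinv \<Gamma> x)"

definition is_walk :: "'a dgraph \<Rightarrow> 'a list \<Rightarrow> bool" where
  "is_walk \<Gamma> xs \<longleftrightarrow> set xs \<subseteq> darts \<Gamma> \<and> successively (\<lambda>x y. dend \<Gamma> x = beg \<Gamma> y) xs"

definition walk_betw :: "'a dgraph \<Rightarrow> 'a \<Rightarrow> 'a list \<Rightarrow> 'a \<Rightarrow> bool" where
  "walk_betw \<Gamma> u xs v \<longleftrightarrow> is_walk \<Gamma> xs \<and>
     (if xs = [] then u = v else beg \<Gamma> (hd xs) = u \<and> dend \<Gamma> (last xs) = v)"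

definition connected_dgraph :: "'a dgraph \<Rightarrow> bool" where
  "connected_dgraph \<Gamma> \<longleftrightarrow> is_dgraph \<Gamma> \<and>
     (\<forall>u \<in> verts \<Gamma>. \<forall>v \<in> verts \<Gamma>. \<exists>xs. walk_betw \<Gamma> u xs v)"

definition dgraph_morphism :: "'a dgraph \<Rightarrow> 'b dgraph \<Rightarrow> ('a \<Rightarrow> 'b) \<Rightarrow> bool" where
  "dgraph_morphism \<Gamma> \<Gamma>' f \<longleftrightarrow> is_dgraph \<Gamma> \<and> is_dgraph \<Gamma>' \<and>
     f \<in> verts \<Gamma> \<rightarrow> verts \<Gamma>' \<and> f \<in> darts \<Gamma> \<rightarrow> darts \<Gamma>' \<and>
     (\<forall>x \<in> darts \<Gamma>. f (beg \<Gamma> x) = beg \<Gamma>' (f x) \<and> f (dinv \<Gamma> x) = dinv \<Gamma>' (f x))"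

definition dgraph_iso :: "'a dgraph \<Rightarrow> 'b dgraph \<Rightarrow> ('a \<Rightarrow> 'b) \<Rightarrow> bool" where
  "dgraph_iso \<Gamma> \<Gamma>' f \<longleftrightarrow> dgraph_morphism \<Gamma> \<Gamma>' f \<and> bij_betw f (elems \<Gamma>) (elems \<Gamma>')"

text \<open>Automorphisms act on the right, so the product of \<open>g\<close> and \<open>h\<close> applies \<open>g\<close> first; this is
  the opposite of the multiplication in \<^const>\<open>BijGroup\<close>.\<close>

definition aut_group :: "'a dgraph \<Rightarrow> ('a \<Rightarrow> 'a) monoid" where
  "aut_group \<Gamma> =
     \<lparr>carrier = {g \<in> extensional (elems \<Gamma>). dgraph_iso \<Gamma> \<Gamma> g},
      mult = (\<lambda>g h. compose (elems \<Gamma>) h g),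
      one = (\<lambda>x \<in> elems \<Gamma>. x)\<rparr>"


section \<open>Quotients\<close>

text \<open>In the following, \<open>A\<close> is a group of permutations acting by evaluation.\<close>

abbreviation orb :: "('a \<Rightarrow> 'a, 'm) monoid_scheme \<Rightarrow> 'a \<Rightarrow> 'a set" where
  "orb A x \<equiv> orbit A (\<lambda>g. g) x"

abbreviation stab :: "('a \<Rightarrow> 'a, 'm) monoid_scheme \<Rightarrow> 'a \<Rightarrow> ('a \<Rightarrow> 'a) set" where
  "stab A x \<equiv> stabilizer A (\<lambda>g. g) x"

definition transversal :: "'a set \<Rightarrow> 'a set set \<Rightarrow> bool" where
  "transversal T P \<longleftrightarrow> T \<subseteq> \<Union>P \<and> (\<forall>B \<in> P. \<exists>!x. x \<in> T \<and> x \<in> B)"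

text \<open>As automorphisms commute with \<open>beg\<close> and \<open>dinv\<close>, the image of the orbit of \<open>x\<close> under either
  map is the orbit of the image of \<open>x\<close>; see \<open>quotient_beg\<close> and \<open>quotient_dinv\<close> below.\<close>

definition quotient_dgraph :: "'a dgraph \<Rightarrow> ('a \<Rightarrow> 'a, 'm) monoid_scheme \<Rightarrow> 'a set dgraph" where
  "quotient_dgraph \<Gamma> A =
     \<lparr>verts = orbits A (verts \<Gamma>) (\<lambda>g. g),
      darts = orbits A (darts \<Gamma>) (\<lambda>g. g),
      beg = (\<lambda>B. beg \<Gamma> ` B),
      dinv = (\<lambda>B. dinv \<Gamma> ` B)\<rparr>"

definition transversal_pair ::
  "'a dgraph \<Rightarrow> ('a \<Rightarrow> 'a, 'm) monoid_scheme \<Rightarrow> 'a set \<Rightarrow> 'a set \<Rightarrow> bool" where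
  "transversal_pair \<Gamma> A TV TD \<longleftrightarrow>
     transversal TV (verts (quotient_dgraph \<Gamma> A)) \<and>
     transversal TD (darts (quotient_dgraph \<Gamma> A)) \<and>
     (\<forall>x \<in> TD. beg \<Gamma> x \<in> TV)"

definition dart_iota ::
  "'a dgraph \<Rightarrow> ('a \<Rightarrow> 'a, 'm) monoid_scheme \<Rightarrow> 'a set \<Rightarrow> 'a \<Rightarrow> 'a" where
  "dart_iota \<Gamma> A TD x = (THE y. y \<in> TD \<and> dinv \<Gamma> x \<in> orb A y)"


section \<open>Generalised voltage graphs and generalised covers\<close>

definition gen_voltage_graph ::
  "'a dgraph \<Rightarrow> ('g, 'm) monoid_scheme \<Rightarrow> ('a \<Rightarrow> 'g set) \<Rightarrow> ('a \<Rightarrow> 'g) \<Rightarrow> bool" where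
  "gen_voltage_graph \<Delta> G \<omega> \<zeta> \<longleftrightarrow>
     connected_dgraph \<Delta> \<and> group G \<and>
     \<omega> \<in> elems \<Delta> \<rightarrow> {H. subgroup H G} \<and>
     \<zeta> \<in> darts \<Delta> \<rightarrow> carrier G \<and>
     (\<forall>x \<in> darts \<Delta>.
        \<omega> x \<subseteq> \<omega> (beg \<Delta> x) \<and>
        \<omega> x = (inv\<^bsub>G\<^esub> \<zeta> x) <#\<^bsub>G\<^esub> \<omega> (dinv \<Delta> x) #>\<^bsub>G\<^esub> \<zeta> x \<and>
        \<zeta> (dinv \<Delta> x) \<otimes>\<^bsub>G\<^esub> \<zeta> x \<in> \<omega> x)"

definition fibre ::
  "('g, 'm) monoid_scheme \<Rightarrow> ('a \<Rightarrow> 'g set) \<Rightarrow> 'a \<Rightarrow> ('a \<times> 'g set) set" where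
  "fibre G \<omega> x = {(x, \<omega> x #>\<^bsub>G\<^esub> g) | g. g \<in> carrier G}"

text \<open>The maps \<open>beg\<close> and \<open>dinv\<close> of the cover are given through a representative \<open>g\<close> of the coset;
  \<open>gen_cov_beg\<close> and \<open>gen_cov_dinv\<close> below show that its choice does not matter.\<close>

definition coset_rep :: "('g, 'm) monoid_scheme \<Rightarrow> 'g set \<Rightarrow> 'g set \<Rightarrow> 'g" where
  "coset_rep G H C = (SOME g. g \<in> carrier G \<and> C = H #>\<^bsub>G\<^esub> g)"

definition gen_cov ::
  "'a dgraph \<Rightarrow> ('g, 'm) monoid_scheme \<Rightarrow> ('a \<Rightarrow> 'g set) \<Rightarrow> ('a \<Rightarrow> 'g) \<Rightarrow> ('a \<times> 'g set) dgraph"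
  where
  "gen_cov \<Delta> G \<omega> \<zeta> =
     \<lparr>verts = (\<Union>v \<in> verts \<Delta>. fibre G \<omega> v),
      darts = (\<Union>x \<in> darts \<Delta>. fibre G \<omega> x),
      beg = (\<lambda>(x, C). (beg \<Delta> x, \<omega> (beg \<Delta> x) #>\<^bsub>G\<^esub> coset_rep G (\<omega> x) C)),
      dinv = (\<lambda>(x, C). (dinv \<Delta> x,
                \<omega> (dinv \<Delta> x) #>\<^bsub>G\<^esub> (\<zeta> x \<otimes>\<^bsub>G\<^esub> coset_rep G (\<omega> x) C)))\<rparr>"


section \<open>Well-definedness\<close>

lemma group_aut_group:
  assumes "is_dgraph \<Gamma>"
  shows "group (aut_group \<Gamma>)"
proof (rule groupI)
  fix g h assume "g \<in> carrier (aut_group \<Gamma>)" "h \<in> carrier (aut_group \<Gamma>)"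
  then have g: "dgraph_iso \<Gamma> \<Gamma> g" and h: "dgraph_iso \<Gamma> \<Gamma> h"
    by (auto simp: aut_group_def)
  have "dgraph_morphism \<Gamma> \<Gamma> (compose (elems \<Gamma>) h g)"
    using g h
    by (auto simp: dgraph_iso_def dgraph_morphism_def compose_def elems_def is_dgraph_def Pi_iff)
  moreover have "bij_betw (compose (elems \<Gamma>) h g) (elems \<Gamma>) (elems \<Gamma>)"
    using g h bij_betw_compose unfolding dgraph_iso_def by blast
  ultimately show "g \<otimes>\<^bsub>aut_group \<Gamma>\<^esub> h \<in> carrier (aut_group \<Gamma>)"
    by (simp add: aut_group_def dgraph_iso_def)
next
  have "dgraph_morphism \<Gamma> \<Gamma> (\<lambda>x \<in> elems \<Gamma>. x)"
    using assms by (auto simp: dgraph_morphism_def elems_def is_dgraph_def)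
  moreover have "bij_betw (\<lambda>x \<in> elems \<Gamma>. x) (elems \<Gamma>) (elems \<Gamma>)"
    by (auto simp: bij_betw_def inj_on_def)
  ultimately show "\<one>\<^bsub>aut_group \<Gamma>\<^esub> \<in> carrier (aut_group \<Gamma>)"
    by (simp add: aut_group_def dgraph_iso_def)
next
  fix f g h
  assume "f \<in> carrier (aut_group \<Gamma>)"
  then have "f \<in> elems \<Gamma> \<rightarrow> elems \<Gamma>"
    by (auto simp: aut_group_def dgraph_iso_def bij_betw_def)
  then show "f \<otimes>\<^bsub>aut_group \<Gamma>\<^esub> g \<otimes>\<^bsub>aut_group \<Gamma>\<^esub> h = f \<otimes>\<^bsub>aut_group \<Gamma>\<^esub> (g \<otimes>\<^bsub>aut_group \<Gamma>\<^esub> h)"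
    by (auto simp: aut_group_def compose_def restrict_def fun_eq_iff)
next
  fix g assume "g \<in> carrier (aut_group \<Gamma>)"
  then show "\<one>\<^bsub>aut_group \<Gamma>\<^esub> \<otimes>\<^bsub>aut_group \<Gamma>\<^esub> g = g"
    by (auto simp: aut_group_def compose_def restrict_def fun_eq_iff extensional_def)
next
  fix g assume "g \<in> carrier (aut_group \<Gamma>)"
  then have g: "dgraph_morphism \<Gamma> \<Gamma> g" "bij_betw g (elems \<Gamma>) (elems \<Gamma>)" "g \<in> extensional (elems \<Gamma>)"
    by (auto simp: aut_group_def dgraph_iso_def)
  define h where "h = (\<lambda>x \<in> elems \<Gamma>. inv_into (elems \<Gamma>) g x)"
  have gh: "g (h x) = x" "h x \<in> elems \<Gamma>" if "x \<in> elems \<Gamma>" for x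
    using that g(2) by (auto simp: h_def bij_betw_def f_inv_into_f inv_into_into)
  have hg: "h (g x) = x" if "x \<in> elems \<Gamma>" for x
    using that g(2) by (auto simp: h_def bij_betw_def)
  have V: "h v \<in> verts \<Gamma>" if "v \<in> verts \<Gamma>" for v
    using gh[of v] that g(1) assms
    unfolding elems_def dgraph_morphism_def is_dgraph_def Pi_iff
    by (metis IntI UnCI UnE empty_iff)
  have D: "h x \<in> darts \<Gamma>" if "x \<in> darts \<Gamma>" for x
    using gh[of x] that g(1) assms
    unfolding elems_def dgraph_morphism_def is_dgraph_def Pi_iff
    by (metis IntI UnCI UnE empty_iff)
  have "h (beg \<Gamma> x) = beg \<Gamma> (h x) \<and> h (dinv \<Gamma> x) = dinv \<Gamma> (h x)" if x: "x \<in> darts \<Gamma>" for x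
  proof -
    have "g (beg \<Gamma> (h x)) = beg \<Gamma> x" "g (dinv \<Gamma> (h x)) = dinv \<Gamma> x"
      using g(1) D[OF x] gh(1)[of x] x by (auto simp: dgraph_morphism_def elems_def)
    moreover have "beg \<Gamma> (h x) \<in> elems \<Gamma>" "dinv \<Gamma> (h x) \<in> elems \<Gamma>"
      using assms D[OF x] by (auto simp: is_dgraph_def elems_def)
    ultimately show ?thesis by (metis hg)
  qed
  then have "dgraph_morphism \<Gamma> \<Gamma> h"
    using assms V D by (auto simp: dgraph_morphism_def)
  moreover have "bij_betw h (elems \<Gamma>) (elems \<Gamma>)"
    unfolding h_def using bij_betw_inv_into[OF g(2)] by (simp cong: bij_betw_cong)
  moreover have "h \<in> extensional (elems \<Gamma>)" by (simp add: h_def)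
  ultimately have "h \<in> carrier (aut_group \<Gamma>)" by (simp add: aut_group_def dgraph_iso_def)
  moreover have "h \<otimes>\<^bsub>aut_group \<Gamma>\<^esub> g = \<one>\<^bsub>aut_group \<Gamma>\<^esub>"
    by (auto simp: aut_group_def compose_def restrict_def fun_eq_iff gh)
  ultimately show "\<exists>h \<in> carrier (aut_group \<Gamma>). h \<otimes>\<^bsub>aut_group \<Gamma>\<^esub> g = \<one>\<^bsub>aut_group \<Gamma>\<^esub>" by blast
qed

lemma aut_comm:
  assumes "carrier A \<subseteq> carrier (aut_group \<Gamma>)" "g \<in> carrier A" "x \<in> darts \<Gamma>"
  shows "g (beg \<Gamma> x) = beg \<Gamma> (g x)" "g (dinv \<Gamma> x) = dinv \<Gamma> (g x)"
  using assms by (auto simp: aut_group_def dgraph_iso_def dgraph_morphism_def)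

lemma quotient_beg:
  assumes "carrier A \<subseteq> carrier (aut_group \<Gamma>)" "x \<in> darts \<Gamma>"
  shows "beg (quotient_dgraph \<Gamma> A) (orb A x) = orb A (beg \<Gamma> x)"
  using aut_comm(1)[OF assms(1) _ assms(2)]
  by (force simp: quotient_dgraph_def orbit_def image_iff)

lemma quotient_dinv:
  assumes "carrier A \<subseteq> carrier (aut_group \<Gamma>)" "x \<in> darts \<Gamma>"
  shows "dinv (quotient_dgraph \<Gamma> A) (orb A x) = orb A (dinv \<Gamma> x)"
  using aut_comm(2)[OF assms(1) _ assms(2)]
  by (force simp: quotient_dgraph_def orbit_def image_iff)

lemma is_dgraph_quotient:
  assumes "is_dgraph \<Gamma>" "subgroup G (aut_group \<Gamma>)"
  shows "is_dgraph (quotient_dgraph \<Gamma> ((aut_group \<Gamma>)\<lparr>carrier := G\<rparr>))"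
proof -
  let ?A = "(aut_group \<Gamma>)\<lparr>carrier := G\<rparr>"
  have sub: "carrier ?A \<subseteq> carrier (aut_group \<Gamma>)"
    using subgroup.subset[OF assms(2)] by simp
  have "\<one>\<^bsub>aut_group \<Gamma>\<^esub> \<in> G" by (rule subgroup.one_closed[OF assms(2)])
  then have self: "x \<in> orb ?A x" if "x \<in> elems \<Gamma>" for x
  proof -
    have "x = \<one>\<^bsub>aut_group \<Gamma>\<^esub> x" using that by (simp add: aut_group_def)
    with \<open>\<one>\<^bsub>aut_group \<Gamma>\<^esub> \<in> G\<close> show ?thesis unfolding orbit_def by auto
  qed
  have "orb ?A v \<noteq> orb ?A x" if v: "v \<in> verts \<Gamma>" and x: "x \<in> darts \<Gamma>" for v x
  proof
    assume "orb ?A v = orb ?A x"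
    moreover have "v \<in> orb ?A v" using v by (intro self) (simp add: elems_def)
    ultimately obtain g where g: "g \<in> G" "v = g x"
      by (auto simp: orbit_def)
    then have "g \<in> darts \<Gamma> \<rightarrow> darts \<Gamma>"
      using sub by (auto simp: aut_group_def dgraph_iso_def dgraph_morphism_def)
    then show False using g v x assms(1) by (auto simp: is_dgraph_def)
  qed
  then have disj: "verts (quotient_dgraph \<Gamma> ?A) \<inter> darts (quotient_dgraph \<Gamma> ?A) = {}"
    by (auto simp: quotient_dgraph_def orbits_def)
  have darts: "darts (quotient_dgraph \<Gamma> ?A) = orb ?A ` darts \<Gamma>"
    and verts: "verts (quotient_dgraph \<Gamma> ?A) = orb ?A ` verts \<Gamma>"
    by (auto simp: quotient_dgraph_def orbits_def)
  show ?thesis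
    unfolding is_dgraph_def[of "quotient_dgraph _ _"]
    using disj assms(1)
    by (auto simp: darts verts quotient_beg[OF sub] quotient_dinv[OF sub] is_dgraph_def Pi_iff)
qed

lemma coset_rep_works:
  assumes "g \<in> carrier G"
  shows "coset_rep G H (H #>\<^bsub>G\<^esub> g) \<in> carrier G \<and>
         H #>\<^bsub>G\<^esub> g = H #>\<^bsub>G\<^esub> coset_rep G H (H #>\<^bsub>G\<^esub> g)"
  unfolding coset_rep_def by (rule someI[where x = g]) (use assms in simp)

lemma coset_rep_in:
  assumes "group G" "subgroup H G" "g \<in> carrier G"
  obtains k where "k \<in> H" "coset_rep G H (H #>\<^bsub>G\<^esub> g) = k \<otimes>\<^bsub>G\<^esub> g"
proof -
  have "coset_rep G H (H #>\<^bsub>G\<^esub> g) \<in> H #>\<^bsub>G\<^esub> g"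
    using coset_rep_works[OF assms(3), of H] group.rcos_self[OF assms(1) _ assms(2)] by metis
  then show ?thesis using that by (auto simp: r_coset_def)
qed

lemma rcos_mult_in:
  assumes "group G" "subgroup H G" "k \<in> H" "g \<in> carrier G"
  shows "H #>\<^bsub>G\<^esub> (k \<otimes>\<^bsub>G\<^esub> g) = H #>\<^bsub>G\<^esub> g"
  by (metis assms group.coset_join2 group.coset_mult_assoc subgroup.mem_carrier subgroup.subset)

lemma gen_voltage_graphD:
  assumes "gen_voltage_graph \<Delta> G \<omega> \<zeta>" "x \<in> darts \<Delta>"
  shows "group G" "is_dgraph \<Delta>"
    and "beg \<Delta> x \<in> verts \<Delta>" "dinv \<Delta> x \<in> darts \<Delta>" "dinv \<Delta> (dinv \<Delta> x) = x"
    and "subgroup (\<omega> x) G" "subgroup (\<omega> (beg \<Delta> x)) G" "subgroup (\<omega> (dinv \<Delta> x)) G"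
    and "\<zeta> x \<in> carrier G"
    and "\<omega> x \<subseteq> \<omega> (beg \<Delta> x)"
    and "\<omega> x = (inv\<^bsub>G\<^esub> \<zeta> x) <#\<^bsub>G\<^esub> \<omega> (dinv \<Delta> x) #>\<^bsub>G\<^esub> \<zeta> x"
    and "\<zeta> (dinv \<Delta> x) \<otimes>\<^bsub>G\<^esub> \<zeta> x \<in> \<omega> x"
  using assms unfolding gen_voltage_graph_def elems_def connected_dgraph_def is_dgraph_def Pi_iff
  by blast+

lemma gen_cov_beg:
  assumes gvg: "gen_voltage_graph \<Delta> G \<omega> \<zeta>" and x: "x \<in> darts \<Delta>" and g: "g \<in> carrier G"
  shows "beg (gen_cov \<Delta> G \<omega> \<zeta>) (x, \<omega> x #>\<^bsub>G\<^esub> g) = (beg \<Delta> x, \<omega> (beg \<Delta> x) #>\<^bsub>G\<^esub> g)"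
proof -
  have G: "group G" and sub: "subgroup (\<omega> x) G" "subgroup (\<omega> (beg \<Delta> x)) G"
    and le: "\<omega> x \<subseteq> \<omega> (beg \<Delta> x)"
    by (fact gen_voltage_graphD[OF gvg x])+
  obtain k where k: "k \<in> \<omega> x" "coset_rep G (\<omega> x) (\<omega> x #>\<^bsub>G\<^esub> g) = k \<otimes>\<^bsub>G\<^esub> g"
    using coset_rep_in[OF G sub(1) g] .
  then show ?thesis
    using rcos_mult_in[OF G sub(2) _ g] le by (auto simp: gen_cov_def)
qed

lemma gen_cov_dinv:
  assumes gvg: "gen_voltage_graph \<Delta> G \<omega> \<zeta>" and x: "x \<in> darts \<Delta>" and g: "g \<in> carrier G"
  shows "dinv (gen_cov \<Delta> G \<omega> \<zeta>) (x, \<omega> x #>\<^bsub>G\<^esub> g) =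
         (dinv \<Delta> x, \<omega> (dinv \<Delta> x) #>\<^bsub>G\<^esub> (\<zeta> x \<otimes>\<^bsub>G\<^esub> g))"
proof -
  have G: "group G" and sub: "subgroup (\<omega> x) G" "subgroup (\<omega> (dinv \<Delta> x)) G"
    and z: "\<zeta> x \<in> carrier G"
    and eq: "\<omega> x = (inv\<^bsub>G\<^esub> \<zeta> x) <#\<^bsub>G\<^esub> \<omega> (dinv \<Delta> x) #>\<^bsub>G\<^esub> \<zeta> x"
    by (fact gen_voltage_graphD[OF gvg x])+
  interpret group G by (rule G)
  obtain k where k: "k \<in> \<omega> x" "coset_rep G (\<omega> x) (\<omega> x #>\<^bsub>G\<^esub> g) = k \<otimes>\<^bsub>G\<^esub> g"
    using coset_rep_in[OF G sub(1) g] .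
  then obtain l where l: "l \<in> \<omega> (dinv \<Delta> x)" "k = inv\<^bsub>G\<^esub> \<zeta> x \<otimes>\<^bsub>G\<^esub> l \<otimes>\<^bsub>G\<^esub> \<zeta> x"
    using eq by (auto simp: l_coset_def r_coset_def)
  have lG: "l \<in> carrier G" using subgroup.mem_carrier[OF sub(2) l(1)] .
  have "\<zeta> x \<otimes>\<^bsub>G\<^esub> (k \<otimes>\<^bsub>G\<^esub> g) = l \<otimes>\<^bsub>G\<^esub> (\<zeta> x \<otimes>\<^bsub>G\<^esub> g)"
    using l z lG g by (simp add: m_assoc[symmetric])
  then show ?thesis
    using k rcos_mult_in[OF G sub(2) l(1), of "\<zeta> x \<otimes>\<^bsub>G\<^esub> g"] z g by (simp add: gen_cov_def)
qed

lemma is_dgraph_gen_cov: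
  assumes gvg: "gen_voltage_graph \<Delta> G \<omega> \<zeta>"
  shows "is_dgraph (gen_cov \<Delta> G \<omega> \<zeta>)"
proof -
  let ?\<Theta> = "gen_cov \<Delta> G \<omega> \<zeta>"
  have \<Delta>: "is_dgraph \<Delta>" and G: "group G"
    using gvg by (auto simp: gen_voltage_graph_def connected_dgraph_def)
  interpret group G by (rule G)
  have z: "\<zeta> x \<in> carrier G" if "x \<in> darts \<Delta>" for x
    by (fact gen_voltage_graphD(9)[OF gvg that])
  have D: "darts ?\<Theta> = {(x, \<omega> x #>\<^bsub>G\<^esub> g) | x g. x \<in> darts \<Delta> \<and> g \<in> carrier G}"
    and V: "verts ?\<Theta> = {(v, \<omega> v #>\<^bsub>G\<^esub> g) | v g. v \<in> verts \<Delta> \<and> g \<in> carrier G}"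
    by (auto simp: gen_cov_def fibre_def)
  have ii: "dinv ?\<Theta> (dinv ?\<Theta> (x, \<omega> x #>\<^bsub>G\<^esub> g)) = (x, \<omega> x #>\<^bsub>G\<^esub> g)"
    if x: "x \<in> darts \<Delta>" and g: "g \<in> carrier G" for x g
  proof -
    have x': "dinv \<Delta> x \<in> darts \<Delta>" "dinv \<Delta> (dinv \<Delta> x) = x"
      by (fact gen_voltage_graphD[OF gvg x])+
    have sub: "subgroup (\<omega> x) G" and "\<zeta> (dinv \<Delta> x) \<otimes>\<^bsub>G\<^esub> \<zeta> x \<in> \<omega> x"
      by (fact gen_voltage_graphD[OF gvg x])+
    then have "\<omega> x #>\<^bsub>G\<^esub> (\<zeta> (dinv \<Delta> x) \<otimes>\<^bsub>G\<^esub> (\<zeta> x \<otimes>\<^bsub>G\<^esub> g)) = \<omega> x #>\<^bsub>G\<^esub> g"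
      using rcos_mult_in[OF G sub _ g] z[OF x] z[OF x'(1)] g by (simp add: m_assoc[symmetric])
    then show ?thesis
      using gen_cov_dinv[OF gvg x g] gen_cov_dinv[OF gvg x'(1), of "\<zeta> x \<otimes>\<^bsub>G\<^esub> g"] z[OF x] g x'
      by simp
  qed
  show ?thesis
    unfolding is_dgraph_def[of ?\<Theta>]
  proof (intro conjI)
    show "verts ?\<Theta> \<noteq> {}" using \<Delta> one_closed by (auto simp: V is_dgraph_def)
    show "verts ?\<Theta> \<inter> darts ?\<Theta> = {}" using \<Delta> by (auto simp: V D is_dgraph_def)
    show "beg ?\<Theta> \<in> darts ?\<Theta> \<rightarrow> verts ?\<Theta>"
    proof
      fix p assume "p \<in> darts ?\<Theta>"
      then obtain x g where p: "p = (x, \<omega> x #>\<^bsub>G\<^esub> g)" "x \<in> darts \<Delta>" "g \<in> carrier G"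
        by (auto simp: D)
      moreover have "beg \<Delta> x \<in> verts \<Delta>" using \<Delta> p(2) by (auto simp: is_dgraph_def)
      ultimately show "beg ?\<Theta> p \<in> verts ?\<Theta>" by (auto simp: gen_cov_beg[OF gvg] V)
    qed
    show "dinv ?\<Theta> \<in> darts ?\<Theta> \<rightarrow> darts ?\<Theta>"
    proof
      fix p assume "p \<in> darts ?\<Theta>"
      then obtain x g where p: "p = (x, \<omega> x #>\<^bsub>G\<^esub> g)" "x \<in> darts \<Delta>" "g \<in> carrier G"
        by (auto simp: D)
      moreover have "dinv \<Delta> x \<in> darts \<Delta>" using \<Delta> p(2) by (auto simp: is_dgraph_def)
      moreover have "\<zeta> x \<otimes>\<^bsub>G\<^esub> g \<in> carrier G" using z p by simp
      ultimately show "dinv ?\<Theta> p \<in> darts ?\<Theta>" by (auto simp: gen_cov_dinv[OF gvg] D)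
    qed
    show "\<forall>p \<in> darts ?\<Theta>. dinv ?\<Theta> (dinv ?\<Theta> p) = p" using ii by (auto simp: D)
  qed
qed

end

theory Submission
  imports Defs
begin

text \<open>Every element of \<open>\<Gamma>\<close> is \<open>t\<^sup>g\<close> for a unique \<open>t\<close> in the transversal, and the \<open>g\<close> that
  occur form one right coset of the stabiliser of \<open>t\<close>. Sending \<open>t\<^sup>g\<close> to the pair of its orbit and
  this coset gives the isomorphism onto the cover. It commutes with \<open>beg\<close> because \<open>beg t\<close> lies in
  the transversal again, and with \<open>inv\<close> because the inverse of \<open>t\<^sup>g\<close> is \<open>\<iota>(t)\<close> moved by
  \<open>\<zeta>(t\<^sup>G)g\<close>.\<close>

section \<open>The right action of a group of automorphisms: orbits, stabilisers and their
  cosets\<close>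

locale dgraph_action =
  fixes \<Gamma> :: "'a dgraph" and G :: "('a \<Rightarrow> 'a) set"
  assumes dgraph: "is_dgraph \<Gamma>" and subgroup: "subgroup G (aut_group \<Gamma>)"
begin

abbreviation A :: "('a \<Rightarrow> 'a) monoid" where "A \<equiv> (aut_group \<Gamma>)\<lparr>carrier := G\<rparr>"
abbreviation Q :: "'a set dgraph" where "Q \<equiv> quotient_dgraph \<Gamma> A"

sublocale group A
  by (rule subgroup.subgroup_is_group[OF subgroup group_aut_group[OF dgraph]])

lemma carrier_subset: "carrier A \<subseteq> carrier (aut_group \<Gamma>)"
  using subgroup.subset[OF subgroup] by simp

lemma dart_closed:
  assumes "x \<in> darts \<Gamma>"
  shows "beg \<Gamma> x \<in> verts \<Gamma>" "dinv \<Gamma> x \<in> darts \<Gamma>" "dinv \<Gamma> (dinv \<Gamma> x) = x"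
  using dgraph assms by (auto simp: is_dgraph_def)

lemma elems_cases [consumes 1, case_names vert dart]:
  assumes "x \<in> elems \<Gamma>"
  obtains "x \<in> verts \<Gamma>" "x \<notin> darts \<Gamma>" | "x \<in> darts \<Gamma>" "x \<notin> verts \<Gamma>"
  using assms dgraph by (auto simp: elems_def is_dgraph_def)

lemma verts_elems: "x \<in> verts \<Gamma> \<Longrightarrow> x \<in> elems \<Gamma>"
  and darts_elems: "x \<in> darts \<Gamma> \<Longrightarrow> x \<in> elems \<Gamma>"
  by (auto simp: elems_def)

lemma act_verts: "g \<in> G \<Longrightarrow> x \<in> verts \<Gamma> \<Longrightarrow> g x \<in> verts \<Gamma>"
  and act_darts: "g \<in> G \<Longrightarrow> x \<in> darts \<Gamma> \<Longrightarrow> g x \<in> darts \<Gamma>"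
  using carrier_subset by (auto simp: aut_group_def dgraph_iso_def dgraph_morphism_def)

lemma act_elems: "g \<in> G \<Longrightarrow> x \<in> elems \<Gamma> \<Longrightarrow> g x \<in> elems \<Gamma>"
  using act_verts act_darts by (auto simp: elems_def)

lemma act_mult: "x \<in> elems \<Gamma> \<Longrightarrow> (g \<otimes>\<^bsub>A\<^esub> h) x = h (g x)"
  by (simp add: aut_group_def compose_def)

lemma act_one: "x \<in> elems \<Gamma> \<Longrightarrow> \<one>\<^bsub>A\<^esub> x = x"
  by (simp add: aut_group_def)

lemma act_inv:
  assumes "g \<in> G" "x \<in> elems \<Gamma>"
  shows "(inv\<^bsub>A\<^esub> g) (g x) = x" "g ((inv\<^bsub>A\<^esub> g) x) = x"
  using act_mult[OF assms(2), of g "inv\<^bsub>A\<^esub> g"] act_mult[OF assms(2), of "inv\<^bsub>A\<^esub> g" g]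
    r_inv[of g] l_inv[of g] assms act_one[OF assms(2)] by auto

lemmas act_comm = aut_comm[OF carrier_subset, simplified]

lemma orb_eq: "orb A x = (\<lambda>g. g x) ` G"
  by (auto simp: orbit_def)

lemma orb_memI: "g \<in> G \<Longrightarrow> g x = y \<Longrightarrow> y \<in> orb A x"
  by (auto simp: orb_eq)

lemma mem_orb: "x \<in> elems \<Gamma> \<Longrightarrow> x \<in> orb A x"
  by (rule orb_memI[OF one_closed[simplified] act_one[simplified]])

lemma orb_verts: "x \<in> verts \<Gamma> \<Longrightarrow> orb A x \<subseteq> verts \<Gamma>"
  and orb_darts: "x \<in> darts \<Gamma> \<Longrightarrow> orb A x \<subseteq> darts \<Gamma>"
  using act_verts act_darts by (auto simp: orb_eq)

lemma orb_act:
  assumes "g \<in> G" "x \<in> elems \<Gamma>"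
  shows "orb A (g x) = orb A x"
proof -
  have "h (g x) \<in> orb A x" if "h \<in> G" for h
    using orb_memI[of "g \<otimes>\<^bsub>A\<^esub> h" x] act_mult[OF assms(2), of g h] m_closed[of g h] assms that
    by simp
  moreover have "h x \<in> orb A (g x)" if "h \<in> G" for h
  proof -
    \<comment> \<open>Products apply the left factor first, so this element goes back from
      \<open>g x\<close> to \<open>x\<close> and then on to \<open>h x\<close>.\<close>
    have "(inv\<^bsub>A\<^esub> g \<otimes>\<^bsub>A\<^esub> h) (g x) = h x"
      using act_mult[OF act_elems[OF assms]] act_inv assms by simp
    moreover have "inv\<^bsub>A\<^esub> g \<otimes>\<^bsub>A\<^esub> h \<in> G" using m_closed inv_closed assms(1) that by simp
    ultimately show ?thesis by (intro orb_memI)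
  qed
  ultimately show ?thesis by (auto simp: orb_eq)
qed

lemma orb_eq_iff:
  assumes "x \<in> elems \<Gamma>" "y \<in> elems \<Gamma>"
  shows "orb A x = orb A y \<longleftrightarrow> x \<in> orb A y"
  using assms mem_orb orb_act by (auto simp: orb_eq[of y])

lemma mem_stab: "g \<in> stab A x \<longleftrightarrow> g \<in> G \<and> g x = x"
  by (simp add: stabilizer_def)

lemma subgroup_stab:
  assumes "x \<in> elems \<Gamma>"
  shows "subgroup (stab A x) A"
proof (rule subgroupI)
  show "stab A x \<noteq> {}" using act_one[OF assms] one_closed mem_stab by fastforce
  fix g h assume g: "g \<in> stab A x" and h: "h \<in> stab A x"
  show "inv\<^bsub>A\<^esub> g \<in> stab A x"
    using g act_inv(1)[of g x] assms inv_closed[of g] by (simp add: mem_stab)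
  show "g \<otimes>\<^bsub>A\<^esub> h \<in> stab A x"
    using g h act_mult[OF assms] m_closed[of g h] by (simp add: mem_stab)
qed (auto simp: mem_stab)

text \<open>Two elements \<open>g\<close> and \<open>h\<close> send \<open>x\<close> to the same
  place exactly when \<open>h\<close> followed by the inverse of \<open>g\<close> fixes
  \<open>x\<close>. This describes a coset by what its members do to \<open>x\<close>, which is how
  \<open>to_cover\<close> is written.\<close>

lemma stab_rcos:
  assumes x: "x \<in> elems \<Gamma>" and g: "g \<in> G"
  shows "stab A x #>\<^bsub>A\<^esub> g = {h \<in> G. h x = g x}"
proof (intro equalityI subsetI)
  fix h assume "h \<in> stab A x #>\<^bsub>A\<^esub> g"
  then show "h \<in> {h \<in> G. h x = g x}"
    using act_mult[OF x] m_closed g by (auto simp: r_coset_def mem_stab)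
next
  fix h assume h: "h \<in> {h \<in> G. h x = g x}"
  have "h \<otimes>\<^bsub>A\<^esub> inv\<^bsub>A\<^esub> g \<in> stab A x"
    using h g x act_mult[OF x] act_inv(1)[OF g x] m_closed[of h "inv\<^bsub>A\<^esub> g"] inv_closed[of g]
    by (simp add: mem_stab)
  moreover have "h = h \<otimes>\<^bsub>A\<^esub> inv\<^bsub>A\<^esub> g \<otimes>\<^bsub>A\<^esub> g"
    using m_assoc[of h "inv\<^bsub>A\<^esub> g" g] l_inv[of g] r_one[of h] inv_closed[of g] h g by auto
  ultimately show "h \<in> stab A x #>\<^bsub>A\<^esub> g" by (auto simp: r_coset_def)
qed

text \<open>An element \<open>h\<close> fixes \<open>g x\<close> exactly when the conjugate of
  \<open>h\<close> that goes along \<open>g\<close>, applies \<open>h\<close> and returns fixes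
  \<open>x\<close>. It supplies the conjugation axiom of a generalised voltage graph.\<close>

lemma stab_act:
  assumes x: "x \<in> elems \<Gamma>" and g: "g \<in> G"
  shows "stab A (g x) = inv\<^bsub>A\<^esub> g <#\<^bsub>A\<^esub> stab A x #>\<^bsub>A\<^esub> g"
proof (intro equalityI subsetI)
  have g': "inv\<^bsub>A\<^esub> g \<in> G" using inv_closed[of g] g by simp
  fix h assume h: "h \<in> stab A (g x)"
  then have hG: "h \<in> G" by (simp add: mem_stab)
  define k where "k = g \<otimes>\<^bsub>A\<^esub> h \<otimes>\<^bsub>A\<^esub> inv\<^bsub>A\<^esub> g"
  have "k \<in> G" unfolding k_def using m_closed[of g h] m_closed[of _ "inv\<^bsub>A\<^esub> g"] g g' hG by simp
  then have "k \<in> stab A x"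
    using h x g act_inv(1) act_mult[OF x] by (simp add: k_def mem_stab)
  moreover have "inv\<^bsub>A\<^esub> g \<otimes>\<^bsub>A\<^esub> k \<otimes>\<^bsub>A\<^esub> g = h"
  proof -
    have "inv\<^bsub>A\<^esub> g \<otimes>\<^bsub>A\<^esub> k = h \<otimes>\<^bsub>A\<^esub> inv\<^bsub>A\<^esub> g"
      using m_assoc[of g h "inv\<^bsub>A\<^esub> g"] inv_solve_left'[of "h \<otimes>\<^bsub>A\<^esub> inv\<^bsub>A\<^esub> g" g k]
        m_closed[of h "inv\<^bsub>A\<^esub> g"] g g' hG \<open>k \<in> G\<close> by (simp add: k_def)
    then show ?thesis using inv_solve_right'[of h "inv\<^bsub>A\<^esub> g \<otimes>\<^bsub>A\<^esub> k" "inv\<^bsub>A\<^esub> g"]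
       m_assoc[of h "inv\<^bsub>A\<^esub> g" g] l_inv[of g] r_one[of h] g g' hG by simp
  qed
  ultimately show "h \<in> inv\<^bsub>A\<^esub> g <#\<^bsub>A\<^esub> stab A x #>\<^bsub>A\<^esub> g"
    by (force simp: l_coset_def r_coset_def)
next
  have g': "inv\<^bsub>A\<^esub> g \<in> G" using inv_closed[of g] g by simp
  fix h assume "h \<in> inv\<^bsub>A\<^esub> g <#\<^bsub>A\<^esub> stab A x #>\<^bsub>A\<^esub> g"
  then obtain k where k: "k \<in> G" "k x = x" "h = inv\<^bsub>A\<^esub> g \<otimes>\<^bsub>A\<^esub> k \<otimes>\<^bsub>A\<^esub> g"
    by (auto simp: l_coset_def r_coset_def mem_stab)
  then have "h \<in> G" using m_closed[of "inv\<^bsub>A\<^esub> g" k] m_closed[of _ g] g g' by simp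
  moreover have "h (g x) = g x"
    using k act_mult[OF act_elems[OF g x]] act_inv(1)[OF g x] by simp
  ultimately show "h \<in> stab A (g x)" by (simp add: mem_stab)
qed

section \<open>The quotient graph and the existence of transversals\<close>

lemma verts_Q: "verts Q = orb A ` verts \<Gamma>"
  and darts_Q: "darts Q = orb A ` darts \<Gamma>"
  by (auto simp: quotient_dgraph_def orbits_def)

lemma elems_Q: "elems Q = orb A ` elems \<Gamma>"
  by (auto simp: elems_def verts_Q darts_Q)

lemmas beg_Q = quotient_beg[OF carrier_subset]
lemmas dinv_Q = quotient_dinv[OF carrier_subset]

lemma transversal_orbs:
  assumes S: "S \<subseteq> elems \<Gamma>" "\<And>x. x \<in> S \<Longrightarrow> orb A x \<subseteq> S"
  shows "transversal T (orb A ` S) \<longleftrightarrow> T \<subseteq> S \<and> (\<forall>y\<in>S. \<exists>!x. x \<in> T \<and> x \<in> orb A y)"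
proof -
  have "\<Union>(orb A ` S) = S"
    using S mem_orb by blast
  then show ?thesis by (simp add: transversal_def)
qed

text \<open>\<open>P\<close> is a wish that some member of every orbit can fulfil. It is trivial for
  vertices; for darts it asks that the beginning lie in the vertex transversal already
  chosen.\<close>

lemma ex_transversal:
  assumes S: "S \<subseteq> elems \<Gamma>" "\<And>x. x \<in> S \<Longrightarrow> orb A x \<subseteq> S"
    and P: "\<And>x. x \<in> S \<Longrightarrow> \<exists>y \<in> orb A x. P y"
  shows "\<exists>T. transversal T (orb A ` S) \<and> (\<forall>x \<in> T. P x)"
proof -
  \<comment> \<open>The choice depends on the orbit and not on one of its elements, so each orbit
    receives a single representative.\<close>
  define r where "r B = (SOME x. x \<in> B \<and> P x)" for B
  have r: "r (orb A x) \<in> orb A x" "P (r (orb A x))" if "x \<in> S" for x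
    using someI_ex[of "\<lambda>y. y \<in> orb A x \<and> P y"] P[OF that] by (auto simp: r_def)
  have "\<exists>!x. x \<in> r ` orb A ` S \<and> x \<in> orb A y" if y: "y \<in> S" for y
  proof (rule ex1I[of _ "r (orb A y)"])
    show "r (orb A y) \<in> r ` orb A ` S \<and> r (orb A y) \<in> orb A y" using r y by auto
    fix x assume "x \<in> r ` orb A ` S \<and> x \<in> orb A y"
    then obtain z where z: "z \<in> S" "x = r (orb A z)" "x \<in> orb A y" by auto
    moreover have "x \<in> elems \<Gamma>" "y \<in> elems \<Gamma>" "z \<in> elems \<Gamma>"
      using z y S by auto
    \<comment> \<open>The element \<open>x\<close> lies in the orbits of both \<open>z\<close> and
      \<open>y\<close>, so these coincide and \<open>r\<close> takes the same value on them.\<close>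
    ultimately show "x = r (orb A y)" using r(1)[OF z(1)] orb_eq_iff by metis
  qed
  moreover have "r ` orb A ` S \<subseteq> S" using r(1) S(2) by blast
  ultimately have "transversal (r ` orb A ` S) (orb A ` S)"
    using transversal_orbs[OF S] by auto
  then show ?thesis using r(2) by blast
qed

lemma ex_transversal_pair: "\<exists>TV TD. transversal_pair \<Gamma> A TV TD"
proof -
  obtain TV where TV: "transversal TV (orb A ` verts \<Gamma>)"
    using ex_transversal[of "verts \<Gamma>" "\<lambda>_. True"] orb_verts mem_orb verts_elems by blast
  have "\<exists>y \<in> orb A x. beg \<Gamma> y \<in> TV" if x: "x \<in> darts \<Gamma>" for x
  proof -
    \<comment> \<open>An automorphism carrying \<open>beg \<Gamma> x\<close> to the chosen vertex
      \<open>v\<close> carries \<open>x\<close> to a dart in its orbit that begins at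
      \<open>v\<close>.\<close>
    obtain v where "v \<in> TV" "v \<in> orb A (beg \<Gamma> x)"
      using TV transversal_orbs[of "verts \<Gamma>" TV] orb_verts verts_elems dart_closed(1)[OF x]
      by (metis subsetI)
    then obtain g where "g \<in> G" "g (beg \<Gamma> x) \<in> TV" by (auto simp: orb_eq)
    then show ?thesis using act_comm(1)[of g x] x by (auto simp: orb_eq)
  qed
  then obtain TD where "transversal TD (orb A ` darts \<Gamma>)" "\<forall>x \<in> TD. beg \<Gamma> x \<in> TV"
    using ex_transversal[of "darts \<Gamma>" "\<lambda>y. beg \<Gamma> y \<in> TV"] orb_darts darts_elems by blast
  then show ?thesis using TV unfolding transversal_pair_def verts_Q darts_Q by blast
qed

end

section \<open>Orbit representatives and the map to the cover\<close>

locale dgraph_transversal = dgraph_action +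
  fixes TV TD :: "'a set"
  assumes pair: "transversal_pair \<Gamma> A TV TD"
begin

lemma TV: "TV \<subseteq> verts \<Gamma>" "y \<in> verts \<Gamma> \<Longrightarrow> \<exists>!x. x \<in> TV \<and> x \<in> orb A y"
  and TD: "TD \<subseteq> darts \<Gamma>" "y \<in> darts \<Gamma> \<Longrightarrow> \<exists>!x. x \<in> TD \<and> x \<in> orb A y"
  using pair transversal_orbs[of "verts \<Gamma>" TV] transversal_orbs[of "darts \<Gamma>" TD]
    orb_verts orb_darts verts_elems darts_elems
  unfolding transversal_pair_def verts_Q darts_Q by (metis subsetI)+

lemma T_elems: "x \<in> TD \<union> TV \<Longrightarrow> x \<in> elems \<Gamma>"
  using TV(1) TD(1) by (auto simp: elems_def)

lemma beg_TD: "x \<in> TD \<Longrightarrow> beg \<Gamma> x \<in> TV"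
  using pair by (simp add: transversal_pair_def)

text \<open>Automorphisms keep vertices and darts apart, so an orbit meets only one of
  \<open>TV\<close> and \<open>TD\<close>, and uniqueness there is uniqueness in the union.\<close>

lemma T_orb_ex1:
  assumes "y \<in> elems \<Gamma>"
  shows "\<exists>!x. x \<in> TD \<union> TV \<and> orb A y = orb A x"
proof -
  have "\<exists>!x. x \<in> TD \<union> TV \<and> x \<in> orb A y"
    using assms
  proof (cases rule: elems_cases)
    case vert
    then have "orb A y \<inter> TD = {}" using act_verts TD(1) dgraph by (auto simp: orb_eq is_dgraph_def)
    then show ?thesis using TV(2)[OF vert(1)] by blast
  next
    case dart
    then have "orb A y \<inter> TV = {}" using act_darts TV(1) dgraph by (auto simp: orb_eq is_dgraph_def)
    then show ?thesis using TD(2)[OF dart(1)] by blast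
  qed
  then show ?thesis using orb_eq_iff[OF T_elems assms] by metis
qed

lemma T_orb_inj: "x \<in> TD \<union> TV \<Longrightarrow> y \<in> TD \<union> TV \<Longrightarrow> orb A x = orb A y \<Longrightarrow> x = y"
  using T_orb_ex1 T_elems by metis

text \<open>Membership in an orbit is symmetric; this orientation is the one that makes the
  description in \<open>dart_iota\<close> well defined.\<close>

lemma TD_orb_ex1:
  assumes "y \<in> darts \<Gamma>"
  shows "\<exists>!x. x \<in> TD \<and> y \<in> orb A x"
proof -
  have "x \<in> orb A y \<longleftrightarrow> y \<in> orb A x" if "x \<in> TD" for x
    using that orb_eq_iff[of x y] orb_eq_iff[of y x] T_elems darts_elems[OF assms] by auto
  then show ?thesis using TD(2)[OF assms] by metis
qed

definition rep :: "'a \<Rightarrow> 'a" where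
  "rep y = (THE x. x \<in> TD \<union> TV \<and> orb A y = orb A x)"

lemma rep:
  assumes "y \<in> elems \<Gamma>"
  shows "rep y \<in> TD \<union> TV" "orb A (rep y) = orb A y"
  using theI'[OF T_orb_ex1[OF assms]] by (simp_all add: rep_def)

lemma rep_act:
  assumes "t \<in> TD \<union> TV" "g \<in> G"
  shows "rep (g t) = t"
  using assms T_orb_inj rep orb_act act_elems T_elems by metis

lemma elem_decomp:
  assumes "y \<in> elems \<Gamma>"
  obtains t g where "t \<in> TD \<union> TV" "g \<in> G" "y = g t"
  using rep[OF assms] mem_orb[OF assms] that by (auto simp: orb_eq)

lemma dart_decomp:
  assumes "y \<in> darts \<Gamma>"
  obtains t g where "t \<in> TD" "g \<in> G" "y = g t"
  using TD_orb_ex1[OF assms] that by (auto simp: orb_eq)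

lemma dart_iota:
  assumes "x \<in> TD"
  shows "dart_iota \<Gamma> A TD x \<in> TD" "dinv \<Gamma> x \<in> orb A (dart_iota \<Gamma> A TD x)"
  using theI'[OF TD_orb_ex1, of "dinv \<Gamma> x"] dart_closed TD(1) assms
  by (auto simp: dart_iota_def)

text \<open>This identifies \<open>dart_iota\<close> as inversion of darts in the quotient, read on
  representatives.\<close>

lemma orb_dart_iota:
  assumes "x \<in> TD"
  shows "orb A (dart_iota \<Gamma> A TD x) = dinv Q (orb A x)"
proof -
  have "x \<in> darts \<Gamma>" using assms TD(1) by auto
  then show ?thesis
    using dart_iota[OF assms] orb_eq_iff[of "dinv \<Gamma> x" "dart_iota \<Gamma> A TD x"] dinv_Q
      dart_closed(2) darts_elems T_elems by simp
qed

text \<open>The second component is a right coset of the stabiliser of \<open>rep y\<close>. Taking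
  all elements that carry \<open>rep y\<close> to \<open>y\<close> avoids choosing one of
  them.\<close>

definition to_cover :: "'a \<Rightarrow> 'a set \<times> ('a \<Rightarrow> 'a) set" where
  "to_cover y = (orb A y, {g \<in> G. g (rep y) = y})"

text \<open>The working form of the map: any way of writing an element as \<open>g t\<close> with
  \<open>t\<close> in the transversal may be used, by \<open>stab_rcos\<close>.\<close>

lemma to_cover_act:
  assumes "t \<in> TD \<union> TV" "g \<in> G"
  shows "to_cover (g t) = (orb A t, stab A t #>\<^bsub>A\<^esub> g)"
  unfolding to_cover_def stab_rcos[OF T_elems[OF assms(1)] assms(2)]
  using assms by (simp add: rep_act orb_act T_elems)

lemma inj_on_to_cover: "inj_on to_cover (elems \<Gamma>)"
proof (rule inj_onI)
  fix x y assume x: "x \<in> elems \<Gamma>" and y: "y \<in> elems \<Gamma>" and eq: "to_cover x = to_cover y"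
  obtain t g where x': "t \<in> TD \<union> TV" "g \<in> G" "x = g t" using elem_decomp[OF x] .
  obtain s h where y': "s \<in> TD \<union> TV" "h \<in> G" "y = h s" using elem_decomp[OF y] .
  have "s = t" using eq x' y' T_orb_inj by (simp add: to_cover_act)
  \<comment> \<open>The common coset is inhabited by \<open>g\<close>, which therefore sends the
    common representative both to \<open>x\<close> and to \<open>y\<close>.\<close>
  moreover have "g \<in> {k \<in> G. k (rep x) = x}" using x' by (simp add: rep_act)
  ultimately show "x = y" using eq x' y' by (auto simp: to_cover_def rep_act)
qed

end

section \<open>The voltage assignment on the quotient and the isomorphism with its cover\<close>

locale dgraph_voltage = dgraph_transversal +
  fixes \<zeta> :: "'a set \<Rightarrow> 'a \<Rightarrow> 'a" and \<omega> :: "'a set \<Rightarrow> ('a \<Rightarrow> 'a) set"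
  assumes connected: "connected_dgraph Q"
    and zeta_closed: "\<zeta> \<in> darts Q \<rightarrow> G"
    and zeta: "x \<in> TD \<Longrightarrow> \<zeta> (orb A x) (dart_iota \<Gamma> A TD x) = dinv \<Gamma> x"
    and omega: "x \<in> TD \<union> TV \<Longrightarrow> \<omega> (orb A x) = stab A x"
begin

abbreviation \<iota> :: "'a \<Rightarrow> 'a" where "\<iota> \<equiv> dart_iota \<Gamma> A TD"

lemma zeta_orb: "x \<in> darts \<Gamma> \<Longrightarrow> \<zeta> (orb A x) \<in> G"
  using zeta_closed by (auto simp: darts_Q)

text \<open>Inverting twice in the quotient returns to the orbit of \<open>x\<close>, in which the
  transversal has only one member.\<close>

lemma dart_iota_iota:
  assumes "x \<in> TD"
  shows "\<iota> (\<iota> x) = x"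
proof -
  have x: "x \<in> darts \<Gamma>" using assms TD(1) by auto
  have "orb A (\<iota> (\<iota> x)) = orb A x"
    using orb_dart_iota[OF assms] orb_dart_iota[OF dart_iota(1)[OF assms]]
      dinv_Q dart_closed(2,3)[OF x] x by simp
  then show ?thesis using T_orb_inj dart_iota(1) assms by blast
qed

text \<open>Automorphisms commute with \<open>dinv\<close>, and \<open>dinv\<close> is injective on
  darts because it is an involution.\<close>

lemma stab_dinv:
  assumes "x \<in> darts \<Gamma>"
  shows "stab A (dinv \<Gamma> x) = stab A x"
proof -
  have "dinv \<Gamma> (g x) = dinv \<Gamma> x \<longleftrightarrow> g x = x" if "g \<in> G" for g
    using dart_closed(3)[OF act_darts[OF that assms]] dart_closed(3)[OF assms] by metis
  then show ?thesis by (auto simp: mem_stab act_comm(2)[OF _ assms])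
qed

text \<open>Each axiom is checked at the representative \<open>x\<close> of a dart. Fixing
  \<open>x\<close> forces fixing its beginning; \<open>\<zeta>\<close> carries
  \<open>\<iota> x\<close> to the inverse of \<open>x\<close>, whose stabiliser is that of
  \<open>x\<close>; and the product of the two voltages fixes \<open>x\<close>.\<close>

lemma gen_voltage_graph_quotient: "gen_voltage_graph Q A \<omega> \<zeta>"
proof -
  have rest: "\<omega> y \<subseteq> \<omega> (beg Q y) \<and>
      \<omega> y = (inv\<^bsub>A\<^esub> \<zeta> y) <#\<^bsub>A\<^esub> \<omega> (dinv Q y) #>\<^bsub>A\<^esub> \<zeta> y \<and>
      \<zeta> (dinv Q y) \<otimes>\<^bsub>A\<^esub> \<zeta> y \<in> \<omega> y" if y: "y \<in> darts Q" for y
  proof -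
    obtain z where z: "y = orb A z" "z \<in> darts \<Gamma>" using y by (auto simp: darts_Q)
    obtain x g where x: "x \<in> TD" "g \<in> G" "z = g x" using dart_decomp[OF z(2)] .
    have xD: "x \<in> darts \<Gamma>" and iD: "\<iota> x \<in> darts \<Gamma>" using x dart_iota(1) TD(1) by auto
    have y: "y = orb A x" using z x orb_act darts_elems[OF xD] by simp
    have dy: "dinv Q y = orb A (\<iota> x)" using y orb_dart_iota[OF x(1)] by simp
    have w: "\<omega> y = stab A x" "\<omega> (beg Q y) = stab A (beg \<Gamma> x)" "\<omega> (dinv Q y) = stab A (\<iota> x)"
      using omega beg_TD dart_iota(1) x(1) beg_Q[OF xD] y dy by auto
    have zy: "\<zeta> y \<in> G" "\<zeta> (dinv Q y) \<in> G" using zeta_orb xD iD y dy by auto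
    have zx: "\<zeta> y (\<iota> x) = dinv \<Gamma> x" using zeta[OF x(1)] y by simp
    \<comment> \<open>This is the condition on \<open>\<zeta>\<close> at \<open>\<iota> x\<close>,
      where \<open>\<iota> (\<iota> x)\<close> is \<open>x\<close>.\<close>
    have zi: "\<zeta> (dinv Q y) x = dinv \<Gamma> (\<iota> x)"
      using zeta[OF dart_iota(1)[OF x(1)]] dart_iota_iota[OF x(1)] dy by simp
    have "stab A x \<subseteq> stab A (beg \<Gamma> x)"
      by (auto simp: mem_stab act_comm(1)[OF _ xD])
    moreover have "stab A x = (inv\<^bsub>A\<^esub> \<zeta> y) <#\<^bsub>A\<^esub> stab A (\<iota> x) #>\<^bsub>A\<^esub> \<zeta> y"
      using stab_act[OF darts_elems[OF iD] zy(1)] zx stab_dinv[OF xD] by simp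
    \<comment> \<open>Inverting both sides of \<open>zx\<close> shows that \<open>\<zeta> y\<close>
      undoes what \<open>zi\<close> does to \<open>x\<close>, so their product stabilises
      \<open>x\<close>.\<close>
    moreover have "\<zeta> y (dinv \<Gamma> (\<iota> x)) = x"
      using act_comm(2)[OF zy(1) iD] zx dart_closed(3)[OF xD] by simp
    then have "\<zeta> (dinv Q y) \<otimes>\<^bsub>A\<^esub> \<zeta> y \<in> stab A x"
      using act_mult[OF darts_elems[OF xD]] zi zy m_closed[of "\<zeta> (dinv Q y)" "\<zeta> y"]
      by (simp add: mem_stab)
    ultimately show ?thesis using w by simp
  qed
  have "\<omega> \<in> elems Q \<rightarrow> {H. subgroup H A}"
  proof
    fix y assume "y \<in> elems Q"
    then obtain z where z: "y = orb A z" "z \<in> elems \<Gamma>" by (auto simp: elems_Q)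
    \<comment> \<open>The value of \<open>\<omega>\<close> is prescribed through representatives
      only, hence the passage from \<open>z\<close> to \<open>rep z\<close>.\<close>
    then have "\<omega> y = stab A (rep z)" using rep[of z] omega[of "rep z"] by simp
    then show "\<omega> y \<in> {H. subgroup H A}" using subgroup_stab T_elems rep(1)[OF z(2)] by simp
  qed
  moreover have "\<zeta> \<in> darts Q \<rightarrow> carrier A" using zeta_closed by simp
  moreover note connected is_group ballI[of "darts Q", OF rest]
  ultimately show ?thesis unfolding gen_voltage_graph_def by (intro conjI)
qed

text \<open>As \<open>g\<close> runs through \<open>G\<close>, the elements \<open>g t\<close>
  exhaust the orbit while the cosets of \<open>g\<close> exhaust the fibre, and
  \<open>to_cover_act\<close> matches the two.\<close>

lemma fibre_orb:
  assumes "t \<in> TD \<union> TV"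
  shows "fibre A \<omega> (orb A t) = to_cover ` orb A t"
  using assms to_cover_act[OF assms] omega[OF assms]
  by (auto simp: fibre_def orb_eq[of t] image_image)

lemma to_cover_orb:
  assumes "y \<in> elems \<Gamma>"
  shows "to_cover ` orb A y = fibre A \<omega> (orb A y)"
  using fibre_orb rep[OF assms] by metis

lemma bij_betw_fibre:
  assumes "B \<in> elems Q"
  shows "bij_betw to_cover B (fibre A \<omega> B)"
proof -
  obtain y where y: "B = orb A y" "y \<in> elems \<Gamma>" using assms by (auto simp: elems_Q)
  then have "B \<subseteq> elems \<Gamma>" using act_elems by (auto simp: orb_eq)
  then show ?thesis
    using inj_on_subset[OF inj_on_to_cover] to_cover_orb y by (simp add: bij_betw_def)
qed

text \<open>A set closed under the action is a union of orbits, each mapped onto its fibre. Applied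
  to vertices and to darts separately, it gives surjectivity on both.\<close>

lemma to_cover_image:
  assumes "S \<subseteq> elems \<Gamma>" "\<And>x. x \<in> S \<Longrightarrow> orb A x \<subseteq> S"
  shows "to_cover ` S = (\<Union>B \<in> orb A ` S. fibre A \<omega> B)"
proof -
  have "S = (\<Union>y \<in> S. orb A y)" using assms mem_orb by blast
  then have "to_cover ` S = (\<Union>y \<in> S. to_cover ` orb A y)" by blast
  also have "\<dots> = (\<Union>y \<in> S. fibre A \<omega> (orb A y))"
    by (intro SUP_cong refl to_cover_orb) (use assms(1) in blast)
  finally show ?thesis by (simp add: image_image)
qed

lemma dgraph_iso_to_cover: "dgraph_iso \<Gamma> (gen_cov Q A \<omega> \<zeta>) to_cover"
proof -
  let ?\<Theta> = "gen_cov Q A \<omega> \<zeta>"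
  note gvg = gen_voltage_graph_quotient
  have V: "to_cover ` verts \<Gamma> = verts ?\<Theta>"
    using to_cover_image[of "verts \<Gamma>"] orb_verts verts_elems verts_Q
    by (auto simp: gen_cov_def)
  have D: "to_cover ` darts \<Gamma> = darts ?\<Theta>"
    using to_cover_image[of "darts \<Gamma>"] orb_darts darts_elems darts_Q
    by (auto simp: gen_cov_def)
  have comm: "to_cover (beg \<Gamma> y) = beg ?\<Theta> (to_cover y) \<and>
      to_cover (dinv \<Gamma> y) = dinv ?\<Theta> (to_cover y)" if y: "y \<in> darts \<Gamma>" for y
  proof -
    obtain t g where t: "t \<in> TD" "g \<in> G" "y = g t" using dart_decomp[OF y] .
    have tD: "t \<in> darts \<Gamma>" and iD: "\<iota> t \<in> darts \<Gamma>" using t dart_iota(1) TD(1) by auto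
    have tQ: "orb A t \<in> darts Q" using tD darts_Q by simp
    have cy: "to_cover y = (orb A t, \<omega> (orb A t) #>\<^bsub>A\<^esub> g)"
      using to_cover_act t omega by simp
    have "to_cover (beg \<Gamma> y) = to_cover (g (beg \<Gamma> t))"
      using act_comm(1)[OF t(2) tD] t(3) by simp
    \<comment> \<open>Since \<open>beg \<Gamma> t\<close> is itself in \<open>TV\<close>, it is its
      own representative and the same \<open>g\<close> serves for the coset.\<close>
    also have "\<dots> = (beg Q (orb A t), \<omega> (beg Q (orb A t)) #>\<^bsub>A\<^esub> g)"
      using to_cover_act[of "beg \<Gamma> t" g] beg_TD[OF t(1)] t(2) beg_Q[OF tD] omega[of "beg \<Gamma> t"]
      by simp
    also have "\<dots> = beg ?\<Theta> (to_cover y)"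
      unfolding cy by (rule gen_cov_beg[OF gvg tQ, symmetric]) (use t in simp)
    finally have b: "to_cover (beg \<Gamma> y) = beg ?\<Theta> (to_cover y)" .
    have zG: "\<zeta> (orb A t) \<otimes>\<^bsub>A\<^esub> g \<in> G" using m_closed[of _ g] zeta_orb[OF tD] t(2) by simp
    \<comment> \<open>The voltage takes \<open>\<iota> t\<close> to the inverse of \<open>t\<close>,
      and \<open>g\<close> takes that to the inverse of \<open>g t\<close>. The factor thus obtained
      is the one in the inversion rule of the cover.\<close>
    have "dinv \<Gamma> y = (\<zeta> (orb A t) \<otimes>\<^bsub>A\<^esub> g) (\<iota> t)"
      using act_comm(2)[OF t(2) tD] t(3) zeta[OF t(1)] act_mult[OF darts_elems[OF iD]] by simp
    then have "to_cover (dinv \<Gamma> y) =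
        (dinv Q (orb A t), \<omega> (dinv Q (orb A t)) #>\<^bsub>A\<^esub> (\<zeta> (orb A t) \<otimes>\<^bsub>A\<^esub> g))"
      using to_cover_act[OF _ zG, of "\<iota> t"] dart_iota(1)[OF t(1)] orb_dart_iota[OF t(1)]
        omega[of "\<iota> t"] by simp
    also have "\<dots> = dinv ?\<Theta> (to_cover y)"
      unfolding cy by (rule gen_cov_dinv[OF gvg tQ, symmetric]) (use t in simp)
    finally show ?thesis using b by simp
  qed
  have "to_cover ` elems \<Gamma> = elems ?\<Theta>" using V D by (simp add: elems_def image_Un)
  then show ?thesis
    using dgraph is_dgraph_gen_cov[OF gvg] V D comm inj_on_to_cover
    by (auto simp: dgraph_iso_def dgraph_morphism_def bij_betw_def)
qed

end

theorem theorem14: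
  fixes \<Gamma> :: "'a dgraph" and G :: "('a \<Rightarrow> 'a) set"
  assumes "is_dgraph \<Gamma>"
    and "subgroup G (aut_group \<Gamma>)"
    and "connected_dgraph (quotient_dgraph \<Gamma> ((aut_group \<Gamma>)\<lparr>carrier := G\<rparr>))"
  shows "let A = (aut_group \<Gamma>)\<lparr>carrier := G\<rparr>; Q = quotient_dgraph \<Gamma> A in
    (\<exists>TV TD. transversal_pair \<Gamma> A TV TD) \<and>
    (\<forall>TV TD. transversal_pair \<Gamma> A TV TD \<longrightarrow>
      (\<forall>y \<in> elems Q. \<exists>!x. x \<in> TD \<union> TV \<and> y = orb A x) \<and>
      (\<forall>x \<in> TD. \<exists>!y. y \<in> TD \<and> dinv \<Gamma> x \<in> orb A y) \<and>
      (\<forall>(\<zeta> :: 'a set \<Rightarrow> 'a \<Rightarrow> 'a) (\<omega> :: 'a set \<Rightarrow> ('a \<Rightarrow> 'a) set).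
        \<zeta> \<in> darts Q \<rightarrow> G \<longrightarrow>
        (\<forall>x \<in> TD. \<zeta> (orb A x) (dart_iota \<Gamma> A TD x) = dinv \<Gamma> x) \<longrightarrow>
        (\<forall>x \<in> TD \<union> TV. \<omega> (orb A x) = stab A x) \<longrightarrow>
        gen_voltage_graph Q A \<omega> \<zeta> \<and>
        (\<exists>\<phi>. dgraph_iso \<Gamma> (gen_cov Q A \<omega> \<zeta>) \<phi> \<and>
          (\<forall>B \<in> elems Q. \<exists>y \<in> elems Q. bij_betw \<phi> B (fibre A \<omega> y)))))"
proof -
  interpret dgraph_action \<Gamma> G using assms(1,2) by (rule dgraph_action.intro)
  have uniq: "(\<forall>y \<in> elems Q. \<exists>!x. x \<in> TD \<union> TV \<and> y = orb A x) \<and>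
      (\<forall>x \<in> TD. \<exists>!y. y \<in> TD \<and> dinv \<Gamma> x \<in> orb A y)"
    if "transversal_pair \<Gamma> A TV TD" for TV TD
  proof -
    interpret dgraph_transversal \<Gamma> G TV TD
      using that by (intro dgraph_transversal.intro dgraph_transversal_axioms.intro dgraph_action_axioms)
    have "\<exists>!y. y \<in> TD \<and> dinv \<Gamma> x \<in> orb A y" if "x \<in> TD" for x
      using TD_orb_ex1 dart_closed(2) TD(1) that by blast
    then show ?thesis using T_orb_ex1 by (simp add: elems_Q)
  qed
  have cover: "gen_voltage_graph Q A \<omega> \<zeta> \<and>
      (\<exists>\<phi>. dgraph_iso \<Gamma> (gen_cov Q A \<omega> \<zeta>) \<phi> \<and>
        (\<forall>B \<in> elems Q. \<exists>y \<in> elems Q. bij_betw \<phi> B (fibre A \<omega> y)))"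
    if "transversal_pair \<Gamma> A TV TD" "\<zeta> \<in> darts Q \<rightarrow> G"
      "\<forall>x \<in> TD. \<zeta> (orb A x) (dart_iota \<Gamma> A TD x) = dinv \<Gamma> x"
      "\<forall>x \<in> TD \<union> TV. \<omega> (orb A x) = stab A x" for TV TD \<zeta> \<omega>
  proof -
    interpret dgraph_voltage \<Gamma> G TV TD \<zeta> \<omega>
      using that assms(3) by (intro dgraph_voltage.intro dgraph_voltage_axioms.intro
        dgraph_transversal.intro dgraph_transversal_axioms.intro dgraph_action_axioms) auto
    \<comment> \<open>The isomorphism is \<open>to_cover\<close>, and the fibre matched with an
      orbit \<open>B\<close> is the one above \<open>B\<close> itself.\<close>
    show ?thesis using gen_voltage_graph_quotient dgraph_iso_to_cover bij_betw_fibre by blast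
  qed
  show ?thesis
    unfolding Let_def
    by (intro conjI allI impI ex_transversal_pair uniq[THEN conjunct1] uniq[THEN conjunct2]
        cover[THEN conjunct1] cover[THEN conjunct2])
qed

end
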